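(* Let $D$ be a Dedekind domain with infinitely many maximal ideals, all of them of finite index, and let $K$ be its quotient field. Then for every $n\ge 1$ there exist elements $H,G_1,\ldots,G_{n+1}$ of $\operatorname{Int}(D)$, each irreducible in $\operatorname{Int}(D)$, such that \[x\,H(x)=G_1(x)\cdots G_{n+1}(x).\]
   Context: $\operatorname{Int}(D)=\{f\in K[x]\mid f(D)\subseteq D\}$ is the ring of integer-valued polynomials on $D$. An element is irreducible if it is a non-zero non-unit that cannot be written as a product of two non-units. *)

theory Defs
  imports "HOL-Computational_Algebra.Polynomial_Factorial"
begin

definition is_ideal :: "'a::comm_ring_1 set \<Rightarrow> bool" where
  "is_ideal I \<longleftrightarrow> 0 \<in> I \<and> (\<forall>x\<in>I. \<forall>y\<in>I. x + y \<in> I) \<and> (\<forall>r. \<forall>x\<in>I. r * x \<in> I)"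

definition is_prime_ideal :: "'a::comm_ring_1 set \<Rightarrow> bool" where
  "is_prime_ideal P \<longleftrightarrow> is_ideal P \<and> P \<noteq> UNIV \<and> (\<forall>x y. x * y \<in> P \<longrightarrow> x \<in> P \<or> y \<in> P)"

definition is_maximal_ideal :: "'a::comm_ring_1 set \<Rightarrow> bool" where
  "is_maximal_ideal M \<longleftrightarrow> is_ideal M \<and> M \<noteq> UNIV \<and>
     (\<forall>J. is_ideal J \<and> M \<subseteq> J \<longrightarrow> J = M \<or> J = UNIV)"

definition finite_index :: "'a::comm_ring_1 set \<Rightarrow> bool" where
  "finite_index M \<longleftrightarrow> finite ((\<lambda>a. (+) a ` M) ` UNIV)"

definition noetherian_ring :: "'a::comm_ring_1 itself \<Rightarrow> bool" where
  "noetherian_ring _ \<longleftrightarrow> (\<forall>I :: nat \<Rightarrow> 'a set. (\<forall>n. is_ideal (I n)) \<and> (\<forall>n. I n \<subseteq> I (Suc n))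
      \<longrightarrow> (\<exists>N. \<forall>n\<ge>N. I n = I N))"

definition integrally_closed :: "'a::idom itself \<Rightarrow> bool" where
  "integrally_closed _ \<longleftrightarrow> (\<forall>x :: 'a fract. \<forall>p :: 'a poly.
      lead_coeff p = 1 \<and> poly (map_poly to_fract p) x = 0 \<longrightarrow> x \<in> range to_fract)"

definition dedekind_domain :: "'a::idom itself \<Rightarrow> bool" where
  "dedekind_domain T \<longleftrightarrow> noetherian_ring T \<and> integrally_closed T \<and>
      (\<forall>P :: 'a set. is_prime_ideal P \<and> P \<noteq> {0} \<longrightarrow> is_maximal_ideal P)"

definition IntD :: "'a::idom fract poly set" where
  "IntD = {f. \<forall>d :: 'a. poly f (to_fract d) \<in> range to_fract}"

definition IntD_unit :: "'a::idom fract poly \<Rightarrow> bool" where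
  "IntD_unit f \<longleftrightarrow> f \<in> IntD \<and> (\<exists>g \<in> IntD. f * g = 1)"

definition IntD_irreducible :: "'a::idom fract poly \<Rightarrow> bool" where
  "IntD_irreducible f \<longleftrightarrow> f \<in> IntD \<and> f \<noteq> 0 \<and> \<not> IntD_unit f \<and>
     (\<forall>g \<in> IntD. \<forall>h \<in> IntD. f = g * h \<longrightarrow> IntD_unit g \<or> IntD_unit h)"

end

theory Submission
  imports Defs
begin

text \<open>
  Let \<open>R\<close> and the members of a finite set \<open>S\<close> be distinct maximal ideals. Choose \<open>c \<notin> R\<close> and \<open>e\<close>
  such that \<open>c \<in> P\<close> and \<open>e \<notin> P\<close> for \<open>P \<in> S\<close>, \<open>e\<close> has valuation one at \<open>R\<close>, and
  \<open>e (\<Inter>S) \<subseteq> (c)\<close>. Let \<open>m\<close> be a common exponent of the unit groups of the residue fields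
  \<open>D / P\<close>, and let \<open>b\<^sub>P\<close> lie in \<open>P\<close> but in no other member of \<open>S\<close>. Put \<open>f = e + (c - e) x\<^sup>m\<close> and
  \<open>L\<^sub>P = b\<^sub>P + (1 - b\<^sub>P) x\<close>. Then \<open>H = f (\<Prod>P\<in>S. L\<^sub>P) / c\<close> and \<open>G = x f / c\<close> are integer-valued, and
  \<open>x H = G (\<Prod>P\<in>S. L\<^sub>P)\<close>.

  The polynomial \<open>f\<close> is irreducible over the fraction field by Eisenstein's criterion at \<open>R\<close>.
  Modulo \<open>P \<in> S\<close> it vanishes at all nonzero residues, whereas the residue \<open>0\<close> is covered by \<open>x\<close> in
  \<open>G\<close> and by \<open>L\<^sub>P\<close> alone in \<open>H\<close>. So in a factorization of \<open>H\<close> or \<open>G\<close> no linear factor can be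
  separated from \<open>f\<close>: compare the values of the two factors at \<open>0\<close> and \<open>1\<close>.
\<close>

section \<open>Ideals\<close>

interpretation ideal: module "(*) :: 'a::comm_ring_1 \<Rightarrow> 'a \<Rightarrow> 'a"
  by standard (simp_all add: algebra_simps)

declare ideal.scale_scale [simp del] \<comment> \<open>loops with \<open>mult.assoc\<close>\<close>

lemma is_ideal_iff_subspace: "is_ideal I \<longleftrightarrow> ideal.subspace I"
  by (auto simp: is_ideal_def ideal.subspace_def)

lemmas ideal_zero = ideal.subspace_0[folded is_ideal_iff_subspace]
lemmas ideal_add = ideal.subspace_add[folded is_ideal_iff_subspace]
lemmas ideal_diff = ideal.subspace_diff[folded is_ideal_iff_subspace]
lemmas ideal_sum = ideal.subspace_sum[folded is_ideal_iff_subspace]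
lemmas ideal_mult_left = ideal.subspace_scale[folded is_ideal_iff_subspace]
lemmas ideal_Int = ideal.subspace_inter[folded is_ideal_iff_subspace]
lemmas ideal_Inter = ideal.subspace_Inter[folded is_ideal_iff_subspace]
lemmas ideal_span = ideal.subspace_span[folded is_ideal_iff_subspace]

lemma ideal_mult_right: "is_ideal I \<Longrightarrow> x \<in> I \<Longrightarrow> x * r \<in> I"
  using ideal_mult_left by (metis mult.commute)

lemma ideal_eq_UNIV_iff:
  assumes "is_ideal I"
  shows "I = UNIV \<longleftrightarrow> 1 \<in> I"
  using ideal_mult_right[OF assms, of 1] by auto

lemma prime_ideal_imp_ideal: "is_prime_ideal P \<Longrightarrow> is_ideal P"
  by (simp add: is_prime_ideal_def)

lemma one_notin_prime_ideal: "is_prime_ideal P \<Longrightarrow> 1 \<notin> P"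
  using ideal_eq_UNIV_iff by (auto simp: is_prime_ideal_def)

lemma mult_in_prime_ideal_iff:
  assumes "is_prime_ideal P"
  shows "x * y \<in> P \<longleftrightarrow> x \<in> P \<or> y \<in> P"
  using assms ideal_mult_left[of P] ideal_mult_right[of P]
  by (auto simp: is_prime_ideal_def)

lemma prod_in_prime_ideal_iff:
  assumes "is_prime_ideal P" "finite A"
  shows "prod f A \<in> P \<longleftrightarrow> (\<exists>i\<in>A. f i \<in> P)"
  using assms(2)
  by (induction A rule: finite_induct)
     (auto simp: mult_in_prime_ideal_iff assms(1) one_notin_prime_ideal)

lemma Inter_subset_prime_ideal:
  assumes "is_prime_ideal P" "finite S" "\<And>I. I \<in> S \<Longrightarrow> is_ideal I" "\<Inter>S \<subseteq> P"
  shows "\<exists>I\<in>S. I \<subseteq> P"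
proof (rule ccontr)
  assume "\<not> ?thesis"
  then have "\<forall>I\<in>S. \<exists>x. x \<in> I \<and> x \<notin> P" by blast
  then obtain x where x: "\<And>I. I \<in> S \<Longrightarrow> x I \<in> I \<and> x I \<notin> P" by metis
  have "prod x S \<in> I" if "I \<in> S" for I
    using x[OF that] that assms(2,3) ideal_mult_right by (metis prod.remove)
  then have "prod x S \<in> P"
    using assms(4) by blast
  then show False
    using x prod_in_prime_ideal_iff[OF assms(1,2)] by blast
qed

lemma maximal_ideal_imp_ideal: "is_maximal_ideal M \<Longrightarrow> is_ideal M"
  by (simp add: is_maximal_ideal_def)

lemma maximal_ideal_imp_prime_ideal:
  assumes "is_maximal_ideal M"
  shows "is_prime_ideal M"
  unfolding is_prime_ideal_def
proof (intro conjI allI impI)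
  show M: "is_ideal M" and "M \<noteq> UNIV"
    using assms by (auto simp: is_maximal_ideal_def)
  fix x y assume "x * y \<in> M"
  define J where "J = {z. z * y \<in> M}"
  have "is_ideal J"
    using M by (auto simp: is_ideal_def J_def distrib_right mult.assoc)
  moreover have "M \<subseteq> J"
    using ideal_mult_right[OF M] by (auto simp: J_def)
  ultimately consider (proper) "J = M" | (improper) "J = UNIV"
    using assms unfolding is_maximal_ideal_def by blast
  then show "x \<in> M \<or> y \<in> M"
  proof cases
    case proper
    with \<open>x * y \<in> M\<close> show ?thesis by (auto simp: J_def)
  next
    case improper
    then have "1 \<in> J" by simp
    then show ?thesis by (simp add: J_def)
  qed
qed

lemma maximal_ideal_subset_iff:
  assumes "is_maximal_ideal M" "is_maximal_ideal N"
  shows "M \<subseteq> N \<longleftrightarrow> M = N"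
  using assms unfolding is_maximal_ideal_def by blast

lemma Inter_maximal_ideals_not_subset:
  assumes "is_maximal_ideal M" "finite S" "\<And>N. N \<in> S \<Longrightarrow> is_maximal_ideal N" "M \<notin> S"
  shows "\<not> \<Inter>S \<subseteq> M"
  using Inter_subset_prime_ideal[OF maximal_ideal_imp_prime_ideal, of M S] assms
  by (metis maximal_ideal_imp_ideal maximal_ideal_subset_iff)

lemma maximal_ideal_nonzero:
  assumes "is_maximal_ideal M" "is_maximal_ideal N" "M \<noteq> N"
  shows "M \<noteq> {0}"
  using assms maximal_ideal_subset_iff ideal_zero[OF maximal_ideal_imp_ideal] by blast

lemma finite_index_power_cong_1:
  assumes P: "is_prime_ideal P" and "finite_index P" and a: "a \<notin> P"
    and N: "card (range (\<lambda>a. (+) a ` P)) \<le> N"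
  shows "1 - a ^ fact N \<in> P"
proof -
  have P_ideal: "is_ideal P" using P by (rule prime_ideal_imp_ideal)
  have "\<not> inj_on (\<lambda>i. (+) (a ^ i) ` P) {..N}"
  proof
    assume "inj_on (\<lambda>i. (+) (a ^ i) ` P) {..N}"
    then have "card {..N} \<le> card (range (\<lambda>a. (+) a ` P))"
      by (rule card_inj_on_le) (use \<open>finite_index P\<close> in \<open>auto simp: finite_index_def\<close>)
    with N show False by simp
  qed
  then obtain i j where ij: "i < j" "j \<le> N" "(+) (a ^ i) ` P = (+) (a ^ j) ` P"
    unfolding inj_on_def by (metis atMost_iff linorder_neqE_nat)
  have "a ^ i + 0 \<in> (+) (a ^ i) ` P" using ideal_zero[OF P_ideal] by blast
  then have "a ^ i - a ^ j \<in> P" using ij(3) by auto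
  also have "a ^ i - a ^ j = a ^ i * (1 - a ^ (j - i))"
    using ij(1) by (simp add: right_diff_distrib flip: power_add)
  finally have "a ^ i \<in> P \<or> 1 - a ^ (j - i) \<in> P"
    by (simp only: mult_in_prime_ideal_iff[OF P])
  moreover have "a ^ i \<notin> P"
    using prod_in_prime_ideal_iff[OF P, of "{..<i}" "\<lambda>_. a"] a by simp
  ultimately have "1 - a ^ (j - i) \<in> P" by blast
  moreover have "j - i dvd fact N" using ij by (intro dvd_fact) auto
  then obtain k where "fact N = (j - i) * k" by blast
  then have "1 - a ^ fact N = (1 - a ^ (j - i)) * (\<Sum>l<k. (a ^ (j - i)) ^ l)"
    using one_diff_power_eq[of "a ^ (j - i)" k] by (simp add: power_mult)
  ultimately show ?thesis using ideal_mult_right[OF P_ideal] by metis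
qed

lemma finite_index_ex_common_exponent:
  assumes "finite S" "\<And>P. P \<in> S \<Longrightarrow> is_prime_ideal P" "\<And>P. P \<in> S \<Longrightarrow> finite_index P"
  shows "\<exists>m>0. \<forall>P\<in>S. \<forall>a. a \<notin> P \<longrightarrow> 1 - a ^ m \<in> P"
proof -
  define N where "N = (\<Sum>P\<in>S. card (range (\<lambda>a. (+) a ` P)))"
  have "1 - a ^ fact N \<in> P" if "P \<in> S" "a \<notin> P" for P a
    unfolding N_def using assms that
    by (intro finite_index_power_cong_1 member_le_sum) auto
  then show ?thesis by (metis fact_gt_zero)
qed

section \<open>Noetherian integrally closed domains\<close>

lemma noetherian_ringD:
  fixes I :: "nat \<Rightarrow> 'a::comm_ring_1 set"
  assumes "noetherian_ring TYPE('a)" "\<And>n. is_ideal (I n)" "\<And>n. I n \<subseteq> I (Suc n)"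
  shows "\<exists>N. \<forall>n\<ge>N. I n = I N"
  using assms by (simp add: noetherian_ring_def)

lemma noetherian_ring_ex_maximal:
  fixes \<C> :: "'a::comm_ring_1 set set"
  assumes "noetherian_ring TYPE('a)" "I0 \<in> \<C>" "\<And>I. I \<in> \<C> \<Longrightarrow> is_ideal I"
  shows "\<exists>I\<in>\<C>. \<forall>J\<in>\<C>. I \<subseteq> J \<longrightarrow> J = I"
proof (rule ccontr)
  assume "\<not> ?thesis"
  then have "\<forall>I\<in>\<C>. \<exists>J\<in>\<C>. I \<subset> J" by blast
  then obtain f where f: "\<And>n. f n \<in> \<C>" "\<And>n. f n \<subset> f (Suc n)"
    using dependent_nat_choice[of "\<lambda>_ I. I \<in> \<C>" "\<lambda>_ I J. I \<subset> J"] assms(2) by metis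
  then obtain N where "\<forall>n\<ge>N. f n = f N"
    using noetherian_ringD[OF assms(1)] assms(3) by (metis psubset_imp_subset)
  then have "f (Suc N) = f N" using le_SucI by blast
  then show False using f(2)[of N] by simp
qed

lemma noetherian_ring_ex_in_span:
  fixes p :: "nat \<Rightarrow> 'a::comm_ring_1"
  assumes "noetherian_ring TYPE('a)"
  shows "\<exists>n. p (Suc n) \<in> ideal.span (p ` {..n})"
proof -
  define I where "I n = ideal.span (p ` {..n})" for n
  have "is_ideal (I n)" for n
    unfolding I_def by (rule ideal_span)
  moreover have "I n \<subseteq> I (Suc n)" for n
    unfolding I_def by (intro ideal.span_mono) auto
  ultimately obtain N where N: "\<forall>n\<ge>N. I n = I N"
    using noetherian_ringD[OF assms, of I] by blast
  have "p (Suc N) \<in> I (Suc N)"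
    unfolding I_def by (intro ideal.span_base) simp
  also have "I (Suc N) = I N" using N le_SucI by blast
  finally show ?thesis unfolding I_def ..
qed

lemma degree_fract_poly: "degree (fract_poly p) = degree p"
  by (simp add: degree_map_poly)

lemma fract_poly_pCons: "fract_poly (pCons a p) = pCons (to_fract a) (fract_poly p)"
  by (simp add: map_poly_pCons)

lemma poly_fract_poly: "poly (fract_poly p) (to_fract a) = to_fract (poly p a)"
  by (induction p) (simp_all add: fract_poly_pCons)

lemma span_geometric_sequence_imp_poly:
  fixes p :: "nat \<Rightarrow> 'a::idom"
  assumes "x \<in> ideal.span (p ` {..n})" and p: "\<And>k. to_fract (p k) = y ^ k * to_fract (p 0)"
  shows "\<exists>q. degree q \<le> n \<and> to_fract x = poly (fract_poly q) y * to_fract (p 0)"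
  using assms(1)
proof (induction rule: ideal.span_induct_alt)
  case base
  show ?case by (intro exI[of _ 0]) simp
next
  case (step c x z)
  then obtain k q where k: "k \<le> n" "x = p k"
    and q: "degree q \<le> n" "to_fract z = poly (fract_poly q) y * to_fract (p 0)"
    by auto
  have "degree (monom c k + q) \<le> n"
    using k(1) q(1) degree_monom_le[of c k] by (intro degree_add_le) auto
  moreover have "to_fract (c * x + z) = poly (fract_poly (monom c k + q)) y * to_fract (p 0)"
    using q(2) p[of k] k(2) by (simp add: map_poly_monom poly_monom algebra_simps)
  ultimately show ?case by blast
qed

lemma integrally_closed_power_eq_poly:
  fixes q :: "'a::idom poly"
  assumes "integrally_closed TYPE('a)" and "degree q \<le> n" and y: "y ^ Suc n = poly (fract_poly q) y"
  shows "y \<in> range to_fract"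
proof -
  define r where "r = monom 1 (Suc n) - q"
  have "degree r = degree (monom (1 :: 'a) (Suc n))"
    unfolding r_def diff_conv_add_uminus using \<open>degree q \<le> n\<close>
    by (intro degree_add_eq_left) (simp add: degree_monom_eq)
  then have "lead_coeff r = 1"
    using \<open>degree q \<le> n\<close> by (simp add: degree_monom_eq r_def coeff_eq_0)
  moreover have "poly (fract_poly r) y = 0"
    using y by (simp add: r_def map_poly_monom poly_monom)
  ultimately show ?thesis
    using assms(1) unfolding integrally_closed_def by blast
qed

text \<open>The determinant trick: \<open>b / a\<close> maps \<open>J\<close> into itself, so it is integral.\<close>

lemma dvd_if_mult_image_subset:
  fixes a b x :: "'a::idom"
  assumes "noetherian_ring TYPE('a)" "integrally_closed TYPE('a)" and "a \<noteq> 0"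
    and J: "(*) b ` J \<subseteq> (*) a ` J" "x \<in> J" "x \<noteq> 0"
  shows "a dvd b"
proof -
  define y where "y = to_fract b / to_fract a"
  have "\<forall>z\<in>J. \<exists>z'\<in>J. b * z = a * z'" using J(1) by blast
  then obtain \<phi> where \<phi>: "\<And>z. z \<in> J \<Longrightarrow> \<phi> z \<in> J \<and> b * z = a * \<phi> z"
    by metis
  define p where "p k = (\<phi> ^^ k) x" for k
  have pJ: "p k \<in> J" for k
    using J(2) \<phi> by (induction k) (auto simp: p_def)
  have geometric: "to_fract (p k) = y ^ k * to_fract (p 0)" for k
  proof (induction k)
    case (Suc k)
    have "to_fract b * to_fract (p k) = to_fract a * to_fract (p (Suc k))"
      using \<phi>[OF pJ[of k]] by (metis to_fract_mult funpow.simps(2) o_apply p_def)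
    then have "to_fract (p (Suc k)) = y * to_fract (p k)"
      using \<open>a \<noteq> 0\<close> by (simp add: y_def field_simps)
    with Suc show ?case by simp
  qed simp
  obtain n where "p (Suc n) \<in> ideal.span (p ` {..n})"
    using noetherian_ring_ex_in_span[OF assms(1)] by blast
  then obtain q where q: "degree q \<le> n" "to_fract (p (Suc n)) = poly (fract_poly q) y * to_fract (p 0)"
    using span_geometric_sequence_imp_poly geometric by blast
  then have "y ^ Suc n = poly (fract_poly q) y"
    using geometric[of "Suc n"] J(3) by (simp add: p_def)
  then obtain z where "y = to_fract z"
    using integrally_closed_power_eq_poly[OF assms(2) q(1)] by blast
  then have "to_fract b = to_fract (a * z)"
    using \<open>a \<noteq> 0\<close> by (simp add: y_def field_simps)
  then show ?thesis by (metis dvd_triv_left to_fract_eq_iff)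
qed

section \<open>Local generators of ideals in a Dedekind domain\<close>

definition colon :: "'a::comm_ring_1 \<Rightarrow> 'a \<Rightarrow> 'a set" where
  "colon a b = {x. a dvd x * b}"

lemma is_ideal_colon: "is_ideal (colon a b)"
  by (auto simp: is_ideal_def colon_def distrib_right mult.assoc)

lemma in_colon_mult_iff: "x \<in> colon a (y * b) \<longleftrightarrow> x * y \<in> colon a b"
  by (simp add: colon_def mult.assoc)

lemma colon_subset_colon_mult: "colon a b \<subseteq> colon a (y * b)"
  using ideal_mult_right[OF is_ideal_colon] by (auto simp: in_colon_mult_iff)

lemma maximal_colon_imp_prime_ideal:
  assumes P: "is_prime_ideal P" and sub: "colon a b \<subseteq> P"
    and max: "\<And>b'. colon a b' \<subseteq> P \<Longrightarrow> colon a b \<subseteq> colon a b' \<Longrightarrow> colon a b' = colon a b"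
  shows "is_prime_ideal (colon a b)"
  unfolding is_prime_ideal_def
proof (intro conjI allI impI is_ideal_colon)
  show "colon a b \<noteq> UNIV"
    using sub one_notin_prime_ideal[OF P] by blast
  fix x y assume xy: "x * y \<in> colon a b"
  show "x \<in> colon a b \<or> y \<in> colon a b"
  proof (cases "colon a (y * b) \<subseteq> P")
    case True
    then have "colon a (y * b) = colon a b"
      by (rule max[OF _ colon_subset_colon_mult])
    with xy show ?thesis by (simp add: in_colon_mult_iff[symmetric])
  next
    case False
    then obtain s where s: "s \<in> colon a (y * b)" "s \<notin> P" by blast
    have "colon a (s * b) \<subseteq> P"
      using sub s(2) mult_in_prime_ideal_iff[OF P] by (auto simp: in_colon_mult_iff)
    then have "colon a (s * b) = colon a b"
      by (rule max[OF _ colon_subset_colon_mult])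
    moreover have "y \<in> colon a (s * b)"
      using s(1) by (metis in_colon_mult_iff mult.commute)
    ultimately show ?thesis by blast
  qed
qed

lemma maximal_ideal_eq_colon:
  fixes P :: "'a::idom set"
  assumes D: "dedekind_domain TYPE('a)" and P: "is_maximal_ideal P" and a: "a \<in> P" "a \<noteq> 0"
  shows "\<exists>b. P = colon a b"
proof -
  have prime: "is_prime_ideal P" using P by (rule maximal_ideal_imp_prime_ideal)
  have "colon a 1 \<subseteq> P"
    using a(1) ideal_mult_right[OF maximal_ideal_imp_ideal[OF P]] by (auto simp: colon_def)
  then have "\<exists>I\<in>colon a ` {b. colon a b \<subseteq> P}. \<forall>J\<in>colon a ` {b. colon a b \<subseteq> P}. I \<subseteq> J \<longrightarrow> J = I"
    using D is_ideal_colon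
    by (intro noetherian_ring_ex_maximal[of "colon a 1"]) (auto simp: dedekind_domain_def)
  then obtain b where sub: "colon a b \<subseteq> P"
    and max: "\<And>b'. colon a b' \<subseteq> P \<Longrightarrow> colon a b \<subseteq> colon a b' \<Longrightarrow> colon a b' = colon a b"
    by auto
  have "is_prime_ideal (colon a b)"
    by (rule maximal_colon_imp_prime_ideal[OF prime sub max])
  moreover have "a \<in> colon a b" by (simp add: colon_def)
  then have "colon a b \<noteq> {0}" using a(2) by blast
  ultimately have "is_maximal_ideal (colon a b)"
    using D by (simp add: dedekind_domain_def)
  then have "P = colon a b"
    using sub P maximal_ideal_subset_iff by blast
  then show ?thesis ..
qed

text \<open>\<open>t\<close> generates the extension of \<open>I\<close> to the localization at \<open>P\<close>; for \<open>I = P\<close> it is a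
  uniformizer.\<close>

definition local_generator :: "'a::comm_ring_1 set \<Rightarrow> 'a set \<Rightarrow> 'a \<Rightarrow> bool" where
  "local_generator P I t \<longleftrightarrow> t \<in> I \<and> (\<exists>s. s \<notin> P \<and> (\<forall>x\<in>I. t dvd s * x))"

lemma local_generator_nonzero:
  fixes P :: "'a::idom set"
  assumes "is_ideal P" "local_generator P I t" "x \<in> I" "x \<noteq> 0"
  shows "t \<noteq> 0"
proof
  assume "t = 0"
  with assms(2,3) obtain s where "s \<notin> P" "s * x = 0"
    by (auto simp: local_generator_def)
  with \<open>x \<noteq> 0\<close> ideal_zero[OF assms(1)] show False by auto
qed

lemma local_generator_notin:
  assumes P: "is_prime_ideal P" and t: "local_generator P I t" and "\<not> I \<subseteq> P"
  shows "t \<notin> P"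
proof
  assume "t \<in> P"
  obtain s x where "s \<notin> P" "x \<in> I" "x \<notin> P" "t dvd s * x"
    using t \<open>\<not> I \<subseteq> P\<close> by (auto simp: local_generator_def)
  moreover from \<open>t \<in> P\<close> \<open>t dvd s * x\<close> have "s * x \<in> P"
    using ideal_mult_right[OF prime_ideal_imp_ideal[OF P]] by auto
  ultimately show False using mult_in_prime_ideal_iff[OF P] by blast
qed

lemma local_generator_Int:
  assumes P: "is_prime_ideal P" and I: "is_ideal I" and J: "is_ideal J" "\<not> J \<subseteq> P"
    and t: "local_generator P (J \<inter> I) t"
  shows "local_generator P I t"
proof -
  obtain s where s: "s \<notin> P" "\<And>x. x \<in> J \<inter> I \<Longrightarrow> t dvd s * x"
    using t by (auto simp: local_generator_def)
  obtain j where j: "j \<in> J" "j \<notin> P" using J(2) by blast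
  have "t dvd (s * j) * x" if "x \<in> I" for x
    using s(2)[of "j * x"] that j(1) ideal_mult_left[OF I] ideal_mult_right[OF J(1)]
    by (simp add: mult.assoc)
  moreover have "s * j \<notin> P"
    using s(1) j(2) mult_in_prime_ideal_iff[OF P] by blast
  ultimately show ?thesis
    using t unfolding local_generator_def by blast
qed

text \<open>Otherwise \<open>b J \<subseteq> p J\<close> for \<open>J = {j. \<forall>x\<in>I. a dvd j * x}\<close> and \<open>P = colon p b\<close>,
  so \<open>p\<close> divides \<open>b\<close>.\<close>

lemma ex_multiplier_not_into_maximal_ideal:
  fixes P :: "'a::idom set"
  assumes D: "dedekind_domain TYPE('a)" and P: "is_maximal_ideal P" "P \<noteq> {0}"
    and a: "a \<in> I" "a \<noteq> 0"
  shows "\<exists>j. (\<forall>x\<in>I. a dvd j * x) \<and> (\<exists>t\<in>I. \<exists>s. j * t = a * s \<and> s \<notin> P)"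
proof (rule ccontr)
  define J where "J = {j. \<forall>x\<in>I. a dvd j * x}"
  assume "\<not> ?thesis"
  then have in_P: "s \<in> P" if "j \<in> J" "t \<in> I" "j * t = a * s" for j t s
    using that unfolding J_def by blast
  obtain p where p: "p \<in> P" "p \<noteq> 0"
    using P(2) ideal_zero[OF maximal_ideal_imp_ideal[OF P(1)]] by blast
  obtain b where b: "P = colon p b"
    using maximal_ideal_eq_colon[OF D P(1) p] by blast
  have "b * j \<in> (*) p ` J" if j: "j \<in> J" for j
  proof -
    have "j \<in> P" using in_P[OF j a(1)] by (simp add: mult.commute)
    then obtain j' where j': "j * b = p * j'" using b by (auto simp: colon_def)
    have "a dvd j' * x" if x: "x \<in> I" for x
    proof -
      obtain s where s: "j * x = a * s" using j x by (auto simp: J_def)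
      then have "s \<in> P" by (rule in_P[OF j x])
      then obtain r where r: "s * b = p * r" using b by (auto simp: colon_def)
      have "p * (j' * x) = (j * x) * b" using j' by (simp add: mult_ac)
      also have "\<dots> = a * (s * b)" using s by (simp add: mult_ac)
      also have "\<dots> = p * (a * r)" using r by (simp add: mult_ac)
      finally show ?thesis using p(2) by simp
    qed
    with j' show ?thesis by (auto simp: J_def mult.commute[of b])
  qed
  moreover have "a \<in> J" by (simp add: J_def)
  ultimately have "p dvd b"
    using dvd_if_mult_image_subset[of p b J a] D a(2) p(2)
    by (auto simp: dedekind_domain_def)
  then show False
    using b one_notin_prime_ideal[OF maximal_ideal_imp_prime_ideal[OF P(1)]] by (simp add: colon_def)
qed

lemma ex_local_generator:
  fixes P :: "'a::idom set"
  assumes D: "dedekind_domain TYPE('a)" and P: "is_maximal_ideal P" "P \<noteq> {0}"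
    and a: "a \<in> I" "a \<noteq> 0"
  shows "\<exists>t. local_generator P I t"
proof -
  obtain j t s where j: "\<And>x. x \<in> I \<Longrightarrow> a dvd j * x" and t: "t \<in> I" and s: "j * t = a * s" "s \<notin> P"
    using ex_multiplier_not_into_maximal_ideal[OF assms] by blast
  have "t dvd s * x" if "x \<in> I" for x
  proof -
    from j[OF that] obtain y where y: "j * x = a * y" ..
    have "a * (s * x) = (j * x) * t" using s(1) by (simp add: mult_ac)
    also have "\<dots> = a * (t * y)" using y by (simp add: mult_ac)
    finally show ?thesis using a(2) by simp
  qed
  with t s(2) show ?thesis unfolding local_generator_def by blast
qed

lemma local_generator_perturb:
  assumes P: "is_prime_ideal P" and I: "is_ideal I" and x: "local_generator P I x" and w: "w \<notin> P"
    and z: "\<And>i. i \<in> A \<Longrightarrow> z i \<in> P" and y: "\<And>i. i \<in> A \<Longrightarrow> y i \<in> I"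
  shows "local_generator P I (w * x + (\<Sum>i\<in>A. z i * y i))"
proof -
  define t where "t = w * x + (\<Sum>i\<in>A. z i * y i)"
  have P_ideal: "is_ideal P" using P by (rule prime_ideal_imp_ideal)
  obtain s where xI: "x \<in> I" and s: "s \<notin> P" "\<And>u. u \<in> I \<Longrightarrow> x dvd s * u"
    using x unfolding local_generator_def by blast
  have "\<forall>i\<in>A. \<exists>q. s * y i = x * q" using s(2) y by (meson dvdE)
  then obtain q where q: "\<And>i. i \<in> A \<Longrightarrow> s * y i = x * q i" by metis
  define v where "v = s * w + (\<Sum>i\<in>A. z i * q i)"
  have "s * t = s * w * x + (\<Sum>i\<in>A. z i * (s * y i))"
    by (simp add: t_def distrib_left sum_distrib_left mult_ac)
  also have "\<dots> = v * x"
    using q by (simp add: v_def algebra_simps sum_distrib_left)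
  finally have st: "s * t = v * x" .
  have "v \<notin> P"
  proof
    assume "v \<in> P"
    moreover have "(\<Sum>i\<in>A. z i * q i) \<in> P"
      using z by (intro ideal_sum ideal_mult_right P_ideal)
    ultimately have "v - (\<Sum>i\<in>A. z i * q i) \<in> P" by (rule ideal_diff[OF P_ideal])
    then show False
      using s(1) w mult_in_prime_ideal_iff[OF P] by (simp add: v_def)
  qed
  then have "v * s \<notin> P" using s(1) mult_in_prime_ideal_iff[OF P] by blast
  moreover have "t dvd (v * s) * u" if "u \<in> I" for u
  proof -
    obtain r where "s * u = x * r" using s(2) \<open>u \<in> I\<close> by (meson dvdE)
    then have "(v * s) * u = (s * t) * r" unfolding st by (simp add: mult.assoc)
    then show ?thesis by simp
  qed
  moreover have "t \<in> I"
    unfolding t_def using xI y by (intro ideal_add ideal_sum ideal_mult_left I)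
  ultimately show ?thesis unfolding local_generator_def t_def by blast
qed

lemma ex_common_local_generator:
  fixes I :: "'a::idom set"
  assumes D: "dedekind_domain TYPE('a)" and S: "finite S" "\<And>P. P \<in> S \<Longrightarrow> is_maximal_ideal P" "{0} \<notin> S"
    and I: "is_ideal I" "I \<noteq> {0}"
  shows "\<exists>t. \<forall>P\<in>S. local_generator P I t"
proof -
  have prime: "is_prime_ideal P" if "P \<in> S" for P
    using S(2)[OF that] by (rule maximal_ideal_imp_prime_ideal)
  have "\<not> \<Inter>(S - {P}) \<subseteq> P" if "P \<in> S" for P
    using S(1,2) that by (intro Inter_maximal_ideals_not_subset) auto
  then have "\<exists>z. z \<notin> P \<and> (\<forall>Q\<in>S - {P}. z \<in> Q)" if "P \<in> S" for P
    using that by blast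
  then obtain z where z: "\<And>P. P \<in> S \<Longrightarrow> z P \<notin> P" "\<And>P Q. P \<in> S \<Longrightarrow> Q \<in> S - {P} \<Longrightarrow> z P \<in> Q"
    by metis
  obtain a where "a \<in> I" "a \<noteq> 0" using I ideal_zero by blast
  then have "\<forall>P\<in>S. \<exists>x. local_generator P I x"
    using ex_local_generator[OF D S(2)] S(3) by blast
  then obtain x where x: "\<And>P. P \<in> S \<Longrightarrow> local_generator P I (x P)" by metis
  have "local_generator P I (\<Sum>Q\<in>S. z Q * x Q)" if P: "P \<in> S" for P
  proof -
    have "local_generator P I (z P * x P + (\<Sum>Q\<in>S - {P}. z Q * x Q))"
      using x z P by (intro local_generator_perturb prime I(1)) (auto simp: local_generator_def)
    then show ?thesis using P S(1) by (simp add: sum.remove)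
  qed
  then show ?thesis by blast
qed

section \<open>Eisenstein's criterion over a Dedekind domain\<close>

lemma fract_poly_common_denominator:
  fixes g :: "'a::idom fract poly"
  shows "\<exists>d p. d \<noteq> 0 \<and> smult (to_fract d) g = fract_poly p"
proof (induction g)
  case 0
  show ?case by (intro exI[of _ 1] exI[of _ 0]) simp
next
  case (pCons x g)
  then obtain d p where dp: "d \<noteq> 0" "smult (to_fract d) g = fract_poly p" by blast
  obtain a b where ab: "b \<noteq> 0" "x = to_fract a / to_fract b"
    by (cases x) (auto simp: Fract_conv_to_fract)
  have "smult (to_fract (b * d)) (pCons x g) = fract_poly (pCons (d * a) (smult b p))"
    using ab by (simp add: fract_poly_pCons dp(2)[symmetric])
  moreover have "b * d \<noteq> 0" using ab(1) dp(1) by simp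
  ultimately show ?case by blast
qed

lemma fract_poly_primitive_part_at:
  fixes g :: "'a::idom fract poly"
  assumes D: "dedekind_domain TYPE('a)" and P: "is_maximal_ideal P" "P \<noteq> {0}" and "g \<noteq> 0"
  shows "\<exists>k p. g = smult k (fract_poly p) \<and> (\<exists>i. coeff p i \<notin> P)"
proof -
  obtain d q where dq: "d \<noteq> 0" "smult (to_fract d) g = fract_poly q"
    using fract_poly_common_denominator by blast
  then have "q \<noteq> 0" using \<open>g \<noteq> 0\<close> by auto
  then have lead: "lead_coeff q \<in> range (coeff q)" "lead_coeff q \<noteq> 0" by auto
  then obtain t where t: "local_generator P (range (coeff q)) t"
    using ex_local_generator[OF D P] by blast
  have "t \<noteq> 0"
    using maximal_ideal_imp_ideal[OF P(1)] t lead by (rule local_generator_nonzero)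
  obtain s j where s: "s \<notin> P" "\<And>i. t dvd s * coeff q i" and j: "t = coeff q j"
    using t by (auto simp: local_generator_def)
  have "s \<noteq> 0" using s(1) ideal_zero[OF maximal_ideal_imp_ideal[OF P(1)]] by auto
  have "[:t:] dvd smult s q" using s(2) by (simp add: const_poly_dvd_iff)
  then obtain p where p: "smult s q = smult t p" by (auto simp: dvd_def)
  have "coeff p j = s"
    using arg_cong[OF p, of "\<lambda>r. coeff r j"] j \<open>t \<noteq> 0\<close> by auto
  then have "coeff p j \<notin> P" using s(1) by simp
  moreover have "smult (to_fract t) (fract_poly p) = smult (to_fract (s * d)) g"
    using dq(2) p by (simp flip: smult_smult fract_poly_smult)
  then have "smult (to_fract t / to_fract (s * d)) (fract_poly p) = g"
    using dq(1) \<open>s \<noteq> 0\<close> smult_eq_iff[of "to_fract (s * d)"] by simp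
  ultimately show ?thesis by blast
qed

lemma fract_poly_primitive_factors_at:
  fixes f :: "'a::idom poly"
  assumes D: "dedekind_domain TYPE('a)" and P: "is_maximal_ideal P" "P \<noteq> {0}"
    and gh: "fract_poly f = g * h" "f \<noteq> 0"
  obtains p q where "degree p = degree g" "degree q = degree h"
    and "\<exists>i. coeff p i \<notin> P" "\<exists>i. coeff q i \<notin> P"
    and "\<And>i j. coeff (p * q) i * coeff f j = coeff (p * q) j * coeff f i"
proof -
  have nonzero: "g \<noteq> 0" "h \<noteq> 0" using gh by auto
  obtain k p where p: "g = smult k (fract_poly p)" "\<exists>i. coeff p i \<notin> P"
    using fract_poly_primitive_part_at[OF D P nonzero(1)] by blast
  obtain l q where q: "h = smult l (fract_poly q)" "\<exists>i. coeff q i \<notin> P"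
    using fract_poly_primitive_part_at[OF D P nonzero(2)] by blast
  have "degree p = degree g" "degree q = degree h"
    using nonzero by (auto simp: p(1) q(1) degree_fract_poly)
  moreover have "fract_poly f = smult (k * l) (fract_poly (p * q))"
    using gh(1) by (simp add: p(1) q(1) mult.commute)
  then have "to_fract (coeff f i) = k * l * to_fract (coeff (p * q) i)" for i
    by (metis coeff_map_poly coeff_smult to_fract_0)
  then have "to_fract (coeff (p * q) i * coeff f j) = to_fract (coeff (p * q) j * coeff f i)" for i j
    by (simp add: mult_ac)
  then have "coeff (p * q) i * coeff f j = coeff (p * q) j * coeff f i" for i j
    by (simp only: to_fract_eq_iff)
  ultimately show thesis using p(2) q(2) that by blast
qed

lemma coeff_mult_least_notin_prime_ideal:
  fixes p q :: "'a::comm_ring_1 poly"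
  assumes P: "is_prime_ideal P"
    and i: "coeff p i \<notin> P" "\<And>k. k < i \<Longrightarrow> coeff p k \<in> P"
    and j: "coeff q j \<notin> P" "\<And>k. k < j \<Longrightarrow> coeff q k \<in> P"
  shows "coeff (p * q) (i + j) \<notin> P"
proof
  assume in_P: "coeff (p * q) (i + j) \<in> P"
  have P_ideal: "is_ideal P" using P by (rule prime_ideal_imp_ideal)
  define r where "r = (\<Sum>k\<in>{..i + j} - {i}. coeff p k * coeff q (i + j - k))"
  have "coeff (p * q) (i + j) = coeff p i * coeff q j + r"
    unfolding coeff_mult r_def by (subst sum.remove[of _ i]) auto
  moreover have "r \<in> P"
    unfolding r_def
  proof (rule ideal_sum[OF P_ideal])
    fix k assume "k \<in> {..i + j} - {i}"
    then have "k < i \<or> i + j - k < j" by force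
    then show "coeff p k * coeff q (i + j - k) \<in> P"
      using i(2) j(2) mult_in_prime_ideal_iff[OF P] by blast
  qed
  ultimately have "coeff p i * coeff q j \<in> P"
    using ideal_diff[OF P_ideal in_P] by force
  then show False using i(1) j(1) mult_in_prime_ideal_iff[OF P] by blast
qed

lemma Eisenstein_primitive_factor_coeffs:
  fixes f p q :: "'a::idom poly"
  assumes P: "is_prime_ideal P"
    and lead: "lead_coeff f \<notin> P" and low: "\<And>i. i < degree f \<Longrightarrow> coeff f i \<in> P"
    and prim: "\<exists>i. coeff p i \<notin> P" "\<exists>j. coeff q j \<notin> P"
    and deg: "degree f = degree p + degree q" "degree p > 0" "degree q > 0"
    and cross: "\<And>k l. coeff (p * q) k * coeff f l = coeff (p * q) l * coeff f k"
  shows "lead_coeff (p * q) \<notin> P" "coeff p 0 \<in> P" "coeff q 0 \<in> P"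
proof -
  have P_ideal: "is_ideal P" using P by (rule prime_ideal_imp_ideal)
  define i where "i = (LEAST i. coeff p i \<notin> P)"
  define j where "j = (LEAST j. coeff q j \<notin> P)"
  have i: "coeff p i \<notin> P" "\<And>k. k < i \<Longrightarrow> coeff p k \<in> P"
    unfolding i_def using LeastI_ex[OF prim(1)] not_less_Least by blast+
  have j: "coeff q j \<notin> P" "\<And>k. k < j \<Longrightarrow> coeff q k \<in> P"
    unfolding j_def using LeastI_ex[OF prim(2)] not_less_Least by blast+
  have pq_ij: "coeff (p * q) (i + j) \<notin> P"
    by (rule coeff_mult_least_notin_prime_ideal[OF P i j])
  with lead have "coeff (p * q) (degree f) * coeff f (i + j) \<notin> P"
    using mult_in_prime_ideal_iff[OF P] cross by metis
  then have "coeff f (i + j) \<notin> P"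
    using ideal_mult_left[OF P_ideal] by blast
  then have "i + j \<ge> degree f" using low by (metis not_less)
  moreover have "i \<le> degree p" "j \<le> degree q"
    using i(1) j(1) ideal_zero[OF P_ideal] by (metis le_degree)+
  ultimately have ij: "i = degree p" "j = degree q" using deg(1) by auto
  then show "coeff p 0 \<in> P" "coeff q 0 \<in> P"
    using i(2) j(2) deg(2,3) by auto
  have "p \<noteq> 0" "q \<noteq> 0" using deg(2,3) by auto
  then show "lead_coeff (p * q) \<notin> P"
    using pq_ij ij by (simp add: degree_mult_eq)
qed

lemma local_generator_not_mult:
  fixes P :: "'a::idom set"
  assumes P: "is_prime_ideal P" and t: "local_generator P P t" "t \<noteq> 0"
    and x: "x \<in> P" "y \<in> P" and w: "w \<notin> P"
  shows "w * t \<noteq> a * (x * y)"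
proof
  assume "w * t = a * (x * y)"
  obtain s where s: "s \<notin> P" "\<forall>x\<in>P. t dvd s * x"
    using t(1) unfolding local_generator_def by blast
  obtain z where z: "s * x = t * z" using s(2) x(1) by (meson dvdE)
  have "t * (s * w) = s * (w * t)" by (simp add: mult_ac)
  also have "\<dots> = (s * x) * (a * y)"
    unfolding \<open>w * t = a * (x * y)\<close> by (simp add: mult_ac)
  also have "\<dots> = t * (z * a * y)"
    unfolding z by (simp add: mult_ac)
  finally have "s * w = z * a * y" using t(2) by simp
  then have "s * w \<in> P"
    using x(2) ideal_mult_left[OF prime_ideal_imp_ideal[OF P]] by simp
  then show False using s(1) w mult_in_prime_ideal_iff[OF P] by blast
qed

theorem Eisenstein_dedekind_domain:
  fixes f :: "'a::idom poly"
  assumes D: "dedekind_domain TYPE('a)" and P: "is_maximal_ideal P" "P \<noteq> {0}"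
    and deg: "degree f > 0" and lead: "lead_coeff f \<notin> P"
    and low: "\<And>i. i < degree f \<Longrightarrow> coeff f i \<in> P" and const: "local_generator P P (coeff f 0)"
  shows "irreducible (fract_poly f)"
proof (rule irreducibleI)
  have prime: "is_prime_ideal P" using P(1) by (rule maximal_ideal_imp_prime_ideal)
  have const_nonzero: "coeff f 0 \<noteq> 0"
    using local_generator_nonzero[OF prime_ideal_imp_ideal[OF prime] const] P(2)
      ideal_zero[OF prime_ideal_imp_ideal[OF prime]] by blast
  have "f \<noteq> 0" using deg by auto
  then show "fract_poly f \<noteq> 0" by simp
  then show "\<not> fract_poly f dvd 1"
    using deg by (simp add: is_unit_iff_degree degree_fract_poly)
  fix g h assume gh: "fract_poly f = g * h"
  then have nonzero: "g \<noteq> 0" "h \<noteq> 0" using \<open>fract_poly f \<noteq> 0\<close> by auto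
  obtain p q where degree_pq: "degree p = degree g" "degree q = degree h"
    and prim: "\<exists>i. coeff p i \<notin> P" "\<exists>i. coeff q i \<notin> P"
    and cross: "\<And>i j. coeff (p * q) i * coeff f j = coeff (p * q) j * coeff f i"
    by (rule fract_poly_primitive_factors_at[OF D P gh \<open>f \<noteq> 0\<close>]) (rule that)
  have "degree (fract_poly f) = degree g + degree h"
    using nonzero by (simp add: gh degree_mult_eq)
  then have degree_f: "degree f = degree p + degree q"
    by (simp only: degree_pq degree_fract_poly)
  have "degree p = 0 \<or> degree q = 0"
  proof (rule ccontr)
    assume "\<not> ?thesis"
    then have "lead_coeff (p * q) \<notin> P" "coeff p 0 \<in> P" "coeff q 0 \<in> P"
      using Eisenstein_primitive_factor_coeffs[OF prime lead low prim degree_f _ _ cross] by auto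
    moreover have "lead_coeff (p * q) * coeff f 0 = coeff f (degree (p * q)) * (coeff p 0 * coeff q 0)"
      using cross[of _ 0] by (simp add: coeff_mult mult.commute)
    ultimately show False
      using local_generator_not_mult[OF prime const const_nonzero] by blast
  qed
  then show "g dvd 1 \<or> h dvd 1"
    using nonzero degree_pq by (simp add: is_unit_iff_degree)
qed

section \<open>Irreducible integer-valued polynomials\<close>

lemma mult_eq_prod_prime_elem:
  fixes p :: "'i \<Rightarrow> 'a::idom"
  assumes "finite S" "\<And>i. i \<in> S \<Longrightarrow> prime_elem (p i)" "g * h = u * (\<Prod>i\<in>S. p i)"
  shows "\<exists>T v w. T \<subseteq> S \<and> v * w = u \<and> g = v * (\<Prod>i\<in>T. p i) \<and> h = w * (\<Prod>i\<in>S - T. p i)"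
  using assms
proof (induction S arbitrary: g h rule: finite_induct)
  case empty
  then show ?case by auto
next
  case (insert x S)
  have nonzero: "p x \<noteq> 0" using insert.prems(1)[of x] by auto
  have eq: "g * h = p x * (u * (\<Prod>i\<in>S. p i))"
    using insert.prems(2) insert.hyps by (simp add: mult_ac)
  have factors: "\<exists>T v w. T \<subseteq> S \<and> v * w = u \<and> g' = v * (\<Prod>i\<in>T. p i) \<and> h' = w * (\<Prod>i\<in>S - T. p i)"
    if "p x * (g' * h') = g * h" for g' h'
    using that eq nonzero insert.prems(1) by (intro insert.IH) auto
  consider (left) g' where "g = p x * g'" | (right) h' where "h = p x * h'"
    using eq insert.prems(1)[of x] by (metis dvdE dvd_triv_left insertI1 prime_elem_dvd_multD)
  then show ?case
  proof cases
    case left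
    then obtain T v w where T: "T \<subseteq> S" "v * w = u" "g' = v * (\<Prod>i\<in>T. p i)" "h = w * (\<Prod>i\<in>S - T. p i)"
      using factors[of g' h] by (auto simp: mult_ac)
    then have "finite T" "x \<notin> T" "insert x S - insert x T = S - T"
      using insert.hyps finite_subset by auto
    with left T show ?thesis
      by (intro exI[of _ "insert x T"] exI[of _ v] exI[of _ w]) (auto simp: mult_ac)
  next
    case right
    then obtain T v w where T: "T \<subseteq> S" "v * w = u" "g = v * (\<Prod>i\<in>T. p i)" "h' = w * (\<Prod>i\<in>S - T. p i)"
      using factors[of g h'] by (auto simp: mult_ac)
    then have "insert x S - T = insert x (S - T)" "x \<notin> S - T"
      using insert.hyps by auto
    with right T insert.hyps(1) show ?thesis
      by (intro exI[of _ T] exI[of _ v] exI[of _ w]) (auto simp: mult_ac)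
  qed
qed

lemma mult_eq_smult_prod_irreducible:
  fixes p :: "'i \<Rightarrow> 'k::field poly"
  assumes "finite S" "\<And>i. i \<in> S \<Longrightarrow> irreducible (p i)" "g * h = smult k (\<Prod>i\<in>S. p i)" "k \<noteq> 0"
  shows "\<exists>T k\<^sub>1 k\<^sub>2. T \<subseteq> S \<and> k\<^sub>1 * k\<^sub>2 = k \<and>
           g = smult k\<^sub>1 (\<Prod>i\<in>T. p i) \<and> h = smult k\<^sub>2 (\<Prod>i\<in>S - T. p i)"
proof -
  have "g * h = [:k:] * (\<Prod>i\<in>S. p i)" using assms(3) by simp
  then obtain T v w where T: "T \<subseteq> S" "g = v * (\<Prod>i\<in>T. p i)" "h = w * (\<Prod>i\<in>S - T. p i)"
    and vw: "v * w = [:k:]"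
    using mult_eq_prod_prime_elem[OF assms(1)] assms(2) field_poly_irreducible_imp_prime by metis
  have "v \<noteq> 0" "w \<noteq> 0" using vw \<open>k \<noteq> 0\<close> by auto
  then have "degree v = 0" "degree w = 0"
    using vw by (metis add_is_0 degree_mult_eq degree_pCons_0)+
  then obtain k\<^sub>1 k\<^sub>2 where "v = [:k\<^sub>1:]" "w = [:k\<^sub>2:]" by (metis degree_eq_zeroE)
  then show ?thesis using T vw by (intro exI[of _ T] exI[of _ k\<^sub>1] exI[of _ k\<^sub>2]) (simp add: mult.commute)
qed

lemma fract_poly_prod: "fract_poly (prod f A) = (\<Prod>i\<in>A. fract_poly (f i))"
  by (induction A rule: infinite_finite_induct) auto

definition quot_poly :: "'a::idom poly \<Rightarrow> 'a \<Rightarrow> 'a fract poly" where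
  "quot_poly p c = smult (1 / to_fract c) (fract_poly p)"

lemma mult_quot_poly: "fract_poly p * quot_poly q c = quot_poly (p * q) c"
  by (simp add: quot_poly_def)

lemma quot_poly_mult: "quot_poly p c * fract_poly q = quot_poly (p * q) c"
  by (simp add: quot_poly_def)

lemma quot_poly_in_IntD_iff:
  assumes "c \<noteq> 0"
  shows "quot_poly p c \<in> IntD \<longleftrightarrow> (\<forall>a. c dvd poly p a)"
proof -
  have "poly (quot_poly p c) (to_fract a) = to_fract d \<longleftrightarrow> poly p a = c * d" for a d
  proof -
    have "poly (quot_poly p c) (to_fract a) = to_fract d \<longleftrightarrow> to_fract (poly p a) = to_fract (c * d)"
      using assms by (auto simp: quot_poly_def poly_fract_poly field_simps)
    then show ?thesis by (simp only: to_fract_eq_iff)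
  qed
  then show ?thesis by (simp add: IntD_def image_iff dvd_def)
qed

lemma IntD_obtain_value:
  assumes "f \<in> IntD"
  obtains d where "poly f (to_fract a) = to_fract d"
  using assms by (auto simp: IntD_def image_iff)

lemma IntD_unit_const:
  assumes "d * d' = 1"
  shows "IntD_unit [:to_fract d:]"
proof -
  have "[:to_fract d:] * [:to_fract d':] = 1"
    using arg_cong[OF assms, of to_fract] by (simp add: one_pCons mult.commute)
  moreover have "[:to_fract x:] \<in> IntD" for x by (auto simp: IntD_def)
  ultimately show ?thesis unfolding IntD_unit_def by blast
qed

text \<open>The value at \<open>v\<close> forces the constants in a factorization to come from units, and the value
  at \<open>u\<close> keeps every \<open>L j\<close> on the same side as \<open>f\<close>.\<close>

locale linked_product =
  fixes f :: "'a::idom poly" and L :: "'i \<Rightarrow> 'a poly" and I :: "'i set" and u v :: 'a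
  assumes finite_I: "finite I"
    and irreducible_f: "irreducible (fract_poly f)"
    and irreducible_L: "i \<in> I \<Longrightarrow> irreducible (fract_poly (L i))"
    and f_v_nonzero: "poly f v \<noteq> 0"
    and L_v: "i \<in> I \<Longrightarrow> poly (L i) v = 1"
    and f_v_dvd: "poly f v dvd poly (f * (\<Prod>i\<in>I. L i)) a"
    and link: "j \<in> I \<Longrightarrow> \<exists>P. is_prime_ideal P \<and> poly f v \<in> P \<and> poly f u \<notin> P \<and>
      (\<forall>i\<in>I - {j}. poly (L i) u \<notin> P)"
begin

definition quotient :: "'a fract poly" where
  "quotient = quot_poly (f * (\<Prod>i\<in>I. L i)) (poly f v)"

lemma quotient_in_IntD: "quotient \<in> IntD"
  using f_v_dvd by (simp add: quotient_def quot_poly_in_IntD_iff f_v_nonzero)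

lemma f_v_dvd_subproduct_imp_eq:
  assumes "T \<subseteq> I" "poly f v dvd poly (f * (\<Prod>i\<in>T. L i)) u"
  shows "T = I"
proof (rule ccontr)
  assume "T \<noteq> I"
  then obtain j where j: "j \<in> I" "j \<notin> T" using \<open>T \<subseteq> I\<close> by blast
  then obtain P where P: "is_prime_ideal P" "poly f v \<in> P" "poly f u \<notin> P"
    and L: "\<And>i. i \<in> I - {j} \<Longrightarrow> poly (L i) u \<notin> P"
    using link by blast
  have "poly f u * (\<Prod>i\<in>T. poly (L i) u) \<in> P"
    using assms(2) P(2) ideal_mult_right[OF prime_ideal_imp_ideal[OF P(1)]] by (auto simp: poly_prod)
  then have "(\<Prod>i\<in>T. poly (L i) u) \<in> P"
    using P(3) mult_in_prime_ideal_iff[OF P(1)] by blast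
  then obtain i where "i \<in> T" "poly (L i) u \<in> P"
    by (auto simp: prod_in_prime_ideal_iff[OF P(1) finite_subset[OF \<open>T \<subseteq> I\<close> finite_I]])
  with L j(2) \<open>T \<subseteq> I\<close> show False by blast
qed

lemma factors_of_quotient:
  assumes gh: "quotient = g * h" and "fract_poly f dvd g"
  shows "\<exists>T k\<^sub>1 k\<^sub>2. T \<subseteq> I \<and> k\<^sub>1 * k\<^sub>2 = 1 / to_fract (poly f v) \<and>
    g = smult k\<^sub>1 (fract_poly (f * (\<Prod>i\<in>T. L i))) \<and> h = smult k\<^sub>2 (fract_poly (\<Prod>i\<in>I - T. L i))"
proof -
  define k where "k = 1 / to_fract (poly f v)"
  have "k \<noteq> 0" using f_v_nonzero by (simp add: k_def)
  obtain g' where g': "g = fract_poly f * g'" using \<open>fract_poly f dvd g\<close> ..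
  have "fract_poly f * (g' * h) = fract_poly f * smult k (\<Prod>i\<in>I. fract_poly (L i))"
    using gh by (simp add: quotient_def g' k_def quot_poly_def fract_poly_prod mult.assoc)
  then have "g' * h = smult k (\<Prod>i\<in>I. fract_poly (L i))"
    using irreducible_f by (auto simp del: mult_smult_right)
  then obtain T k\<^sub>1 k\<^sub>2 where "T \<subseteq> I" "k\<^sub>1 * k\<^sub>2 = k"
    "g' = smult k\<^sub>1 (\<Prod>i\<in>T. fract_poly (L i))" "h = smult k\<^sub>2 (\<Prod>i\<in>I - T. fract_poly (L i))"
    using mult_eq_smult_prod_irreducible[OF finite_I, of "\<lambda>i. fract_poly (L i)" g' h k]
      irreducible_L \<open>k \<noteq> 0\<close> by auto
  then show ?thesis
    by (intro exI[of _ T] exI[of _ k\<^sub>1] exI[of _ k\<^sub>2]) (simp add: g' k_def fract_poly_prod)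
qed

lemma IntD_unit_cofactor:
  assumes g: "g \<in> IntD" "fract_poly f dvd g" and h: "h \<in> IntD" and gh: "quotient = g * h"
  shows "IntD_unit h"
proof -
  define c where "c = poly f v"
  have c: "to_fract c \<noteq> 0" using f_v_nonzero by (simp add: c_def)
  obtain T k\<^sub>1 k\<^sub>2 where T: "T \<subseteq> I" and k: "k\<^sub>1 * k\<^sub>2 = 1 / to_fract c"
    and g_eq: "g = smult k\<^sub>1 (fract_poly (f * (\<Prod>i\<in>T. L i)))"
    and h_eq: "h = smult k\<^sub>2 (fract_poly (\<Prod>i\<in>I - T. L i))"
    using factors_of_quotient[OF gh g(2)] unfolding c_def by blast
  have prod_v: "poly (\<Prod>i\<in>A. L i) v = 1" if "A \<subseteq> I" for A
    using that L_v by (auto simp: poly_prod subset_iff intro: prod.neutral)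
  obtain d where "poly g (to_fract v) = to_fract d"
    using g(1) by (rule IntD_obtain_value)
  then have k\<^sub>1: "k\<^sub>1 = to_fract d / to_fract c"
    using prod_v[OF T] c
    by (simp add: g_eq poly_fract_poly c_def field_simps del: fract_poly_mult)
  obtain d' where "poly h (to_fract v) = to_fract d'"
    using h by (rule IntD_obtain_value)
  then have k\<^sub>2: "k\<^sub>2 = to_fract d'"
    using prod_v[of "I - T"] by (simp add: h_eq poly_fract_poly)
  have "to_fract (d * d') = to_fract 1"
    using k c by (simp add: k\<^sub>1 k\<^sub>2)
  then have unit: "d * d' = 1" by (simp only: to_fract_eq_iff)
  obtain e where "poly g (to_fract u) = to_fract e"
    using g(1) by (rule IntD_obtain_value)
  then have "to_fract (d * poly (f * (\<Prod>i\<in>T. L i)) u) = to_fract (c * e)"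
    using c by (simp add: g_eq poly_fract_poly k\<^sub>1 field_simps del: fract_poly_mult)
  then have e: "d * poly (f * (\<Prod>i\<in>T. L i)) u = c * e" by (simp only: to_fract_eq_iff)
  have "poly (f * (\<Prod>i\<in>T. L i)) u = (d * d') * poly (f * (\<Prod>i\<in>T. L i)) u"
    using unit by simp
  also have "\<dots> = c * (e * d')"
    using e by (simp only: mult_ac)
  finally have "T = I"
    using T f_v_dvd_subproduct_imp_eq by (simp add: c_def)
  then have "h = [:to_fract d':]" by (simp add: h_eq k\<^sub>2)
  then show ?thesis using unit IntD_unit_const by (simp add: mult.commute)
qed

theorem IntD_irreducible_quotient: "IntD_irreducible quotient"
  unfolding IntD_irreducible_def
proof (intro conjI ballI impI)
  have prime: "prime_elem (fract_poly f)"
    using irreducible_f by (rule field_poly_irreducible_imp_prime)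
  have dvd: "fract_poly f dvd quotient"
    by (simp add: quotient_def quot_poly_def dvd_smult)
  show "quotient \<in> IntD" by (rule quotient_in_IntD)
  have "fract_poly (L i) \<noteq> 0" if "i \<in> I" for i
    using irreducible_L[OF that] by auto
  moreover have "fract_poly f \<noteq> 0" using prime by auto
  ultimately show "quotient \<noteq> 0"
    using f_v_nonzero finite_I by (auto simp: quotient_def quot_poly_def)
  show "\<not> IntD_unit quotient"
  proof
    assume "IntD_unit quotient"
    then have "quotient dvd 1" unfolding IntD_unit_def by (metis dvd_triv_left)
    with dvd have "fract_poly f dvd 1" by (rule dvd_trans)
    with prime show False by (simp add: prime_elem_def)
  qed
  fix g h assume gh: "g \<in> IntD" "h \<in> IntD" "quotient = g * h"
  from dvd prime consider "fract_poly f dvd g" | "fract_poly f dvd h"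
    unfolding gh(3) by (blast dest: prime_elem_dvd_multD)
  then show "IntD_unit g \<or> IntD_unit h"
    using IntD_unit_cofactor gh mult.commute[of g h] by cases metis+
qed

end

lemma IntD_irreducible_fract_poly:
  assumes "irreducible (fract_poly p)" "poly p v = 1"
  shows "IntD_irreducible (fract_poly p)"
proof -
  interpret linked_product p "\<lambda>_. 1" "{}" 0 v
    by standard (use assms in auto)
  show ?thesis using IntD_irreducible_quotient assms(2) by (simp add: quotient_def quot_poly_def)
qed

section \<open>Construction of the factorizations\<close>

definition interp_poly :: "nat \<Rightarrow> 'a::comm_ring_1 \<Rightarrow> 'a \<Rightarrow> 'a poly" where
  "interp_poly m e c = [:e:] + monom (c - e) m"

lemma poly_interp_poly: "poly (interp_poly m e c) a = e * (1 - a ^ m) + c * a ^ m"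
  by (simp add: interp_poly_def poly_monom algebra_simps)

lemma coeff_interp_poly:
  "m > 0 \<Longrightarrow> coeff (interp_poly m e c) i = (if i = 0 then e else if i = m then c - e else 0)"
  by (simp add: interp_poly_def coeff_pCons split: nat.split)

lemma degree_interp_poly: "m > 0 \<Longrightarrow> e \<noteq> c \<Longrightarrow> degree (interp_poly m e c) = m"
  unfolding interp_poly_def by (subst degree_add_eq_right) (auto simp: degree_monom_eq)

lemma irreducible_interp_poly:
  fixes R :: "'a::idom set"
  assumes D: "dedekind_domain TYPE('a)" and R: "is_maximal_ideal R" "R \<noteq> {0}"
    and e: "local_generator R R e" and c: "c \<notin> R" and m: "m > 0"
  shows "irreducible (fract_poly (interp_poly m e c))"
proof -
  have ideal: "is_ideal R" using R(1) by (rule maximal_ideal_imp_ideal)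
  have "e \<in> R" using e by (simp add: local_generator_def)
  then have "c - e \<notin> R" using c ideal_add[OF ideal, of "c - e" e] by auto
  have "e \<noteq> c" using \<open>e \<in> R\<close> c by blast
  then have "degree (interp_poly m e c) = m" by (rule degree_interp_poly[OF m])
  then show ?thesis
    using \<open>c - e \<notin> R\<close> \<open>e \<in> R\<close> m e ideal_zero[OF ideal]
    by (intro Eisenstein_dedekind_domain[OF D R]) (auto simp: coeff_interp_poly)
qed

lemma ex_uniformizer_avoiding:
  fixes S :: "'a::idom set set"
  assumes D: "dedekind_domain TYPE('a)" and "finite S" and R: "is_maximal_ideal R" "R \<notin> S"
    and S: "\<And>P. P \<in> S \<Longrightarrow> is_maximal_ideal P" and nonzero: "{0} \<notin> insert R S"
    and J: "is_ideal J" "\<And>P. P \<in> insert R S \<Longrightarrow> \<not> J \<subseteq> P"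
  shows "\<exists>e\<in>J. local_generator R R e \<and> (\<forall>P\<in>S. e \<notin> P)"
proof -
  have maximal: "is_maximal_ideal P" if "P \<in> insert R S" for P
    using that R S by auto
  have prime: "is_prime_ideal P" and ideal: "is_ideal P" if "P \<in> insert R S" for P
    using maximal[OF that] by (simp_all add: maximal_ideal_imp_ideal maximal_ideal_imp_prime_ideal)
  have JR: "is_ideal (J \<inter> R)" using J(1) ideal by (intro ideal_Int) auto
  have "\<exists>r\<in>R. r \<noteq> 0" using nonzero ideal_zero[OF ideal, of R] by blast
  then obtain j r where "j \<in> J" "j \<notin> R" "r \<in> R" "r \<noteq> 0" using J(2)[of R] by blast
  then have "j * r \<in> J \<inter> R" "j * r \<noteq> 0"
    using ideal_mult_left[OF ideal, of R] ideal_mult_right[OF J(1)] ideal_zero[OF ideal, of R] by auto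
  then have "J \<inter> R \<noteq> {0}" by blast
  then obtain e where e: "\<And>P. P \<in> insert R S \<Longrightarrow> local_generator P (J \<inter> R) e"
    using ex_common_local_generator[OF D finite.insertI[OF \<open>finite S\<close>] maximal nonzero JR] by blast
  have "local_generator R R e"
    by (rule local_generator_Int[OF prime ideal J e]) auto
  moreover have "e \<notin> P" if P: "P \<in> S" for P
  proof -
    have "\<not> R \<subseteq> P" using maximal_ideal_subset_iff[OF R(1) S[OF P]] R(2) P by blast
    then have "\<not> J \<inter> R \<subseteq> P"
      using Inter_subset_prime_ideal[of P "{J, R}"] prime[of P] ideal[of R] J(1) J(2)[of P] P by auto
    then show ?thesis using local_generator_notin[OF prime e] P by blast
  qed
  moreover have "e \<in> J" using e[of R] by (auto simp: local_generator_def)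
  ultimately show ?thesis by blast
qed

lemma ex_interpolation_values:
  fixes S :: "'a::idom set set"
  assumes D: "dedekind_domain TYPE('a)" and "finite S" and R: "is_maximal_ideal R" "R \<notin> S"
    and S: "\<And>P. P \<in> S \<Longrightarrow> is_maximal_ideal P" and nonzero: "{0} \<notin> insert R S"
  shows "\<exists>c e. c \<notin> R \<and> local_generator R R e \<and> (\<forall>P\<in>S. c \<in> P \<and> e \<notin> P) \<and> (\<forall>x\<in>\<Inter>S. c dvd e * x)"
proof -
  have maximal: "is_maximal_ideal P" if "P \<in> insert R S" for P
    using that R S by auto
  have Inter: "is_ideal (\<Inter>S)"
    using S by (intro ideal_Inter) (auto intro: maximal_ideal_imp_ideal)
  have Inter_R: "\<not> \<Inter>S \<subseteq> R"
    by (rule Inter_maximal_ideals_not_subset[OF R(1) \<open>finite S\<close> S R(2)])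
  then have "\<Inter>S \<noteq> {0}"
    using ideal_zero[OF maximal_ideal_imp_ideal[OF R(1)]] by auto
  then obtain c where c: "\<And>P. P \<in> insert R S \<Longrightarrow> local_generator P (\<Inter>S) c"
    using ex_common_local_generator[OF D finite.insertI[OF \<open>finite S\<close>] maximal nonzero Inter] by blast
  have "c \<notin> R"
    using local_generator_notin[OF maximal_ideal_imp_prime_ideal[OF R(1)] c Inter_R] by blast
  moreover have "c \<in> P" if "P \<in> S" for P
    using c[of R] that by (auto simp: local_generator_def)
  moreover define J where "J = {a. \<forall>x\<in>\<Inter>S. c dvd a * x}"
  have J: "is_ideal J" by (auto simp: is_ideal_def J_def distrib_right mult.assoc)
  have J_not_subset: "\<not> J \<subseteq> P" if "P \<in> insert R S" for P
    using c[OF that] unfolding local_generator_def J_def by blast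
  obtain e where "e \<in> J" "local_generator R R e" "\<forall>P\<in>S. e \<notin> P"
    using ex_uniformizer_avoiding[OF D \<open>finite S\<close> R S nonzero J J_not_subset] by blast
  moreover from \<open>e \<in> J\<close> have "\<forall>x\<in>\<Inter>S. c dvd e * x" by (simp add: J_def)
  ultimately show ?thesis by blast
qed

text \<open>The last condition says that \<open>poly f a / poly f 1\<close> is integral at every \<open>P \<in> S\<close> not containing
  \<open>a\<close>.\<close>

definition nonzero_residue_cover :: "'a::idom set set \<Rightarrow> 'a poly \<Rightarrow> bool" where
  "nonzero_residue_cover S f \<longleftrightarrow> irreducible (fract_poly f) \<and> poly f 1 \<noteq> 0 \<and>
     (\<forall>P\<in>S. poly f 1 \<in> P \<and> poly f 0 \<notin> P) \<and>
     (\<forall>a q. (\<forall>P\<in>S. a \<in> P \<longrightarrow> q \<in> P) \<longrightarrow> poly f 1 dvd poly f a * q)"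

lemma ex_nonzero_residue_cover:
  fixes S :: "'a::idom set set"
  assumes D: "dedekind_domain TYPE('a)" and "finite S" and R: "is_maximal_ideal R" "R \<notin> S"
    and S: "\<And>P. P \<in> S \<Longrightarrow> is_maximal_ideal P" "\<And>P. P \<in> S \<Longrightarrow> finite_index P"
    and nonzero: "{0} \<notin> insert R S"
  shows "\<exists>f. nonzero_residue_cover S f"
proof -
  have prime: "is_prime_ideal P" if "P \<in> S" for P
    using S(1)[OF that] by (rule maximal_ideal_imp_prime_ideal)
  obtain c e where c: "c \<notin> R" "\<And>P. P \<in> S \<Longrightarrow> c \<in> P"
    and e: "local_generator R R e" "\<And>P. P \<in> S \<Longrightarrow> e \<notin> P"
    and dvd: "\<And>x. x \<in> \<Inter>S \<Longrightarrow> c dvd e * x"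
    using ex_interpolation_values[OF D \<open>finite S\<close> R S(1) nonzero] by auto
  obtain m where m: "m > 0" "\<And>P a. P \<in> S \<Longrightarrow> a \<notin> P \<Longrightarrow> 1 - a ^ m \<in> P"
    using finite_index_ex_common_exponent[OF \<open>finite S\<close> prime S(2)] by blast
  define f where "f = interp_poly m e c"
  have "irreducible (fract_poly f)"
    unfolding f_def using nonzero by (intro irreducible_interp_poly[OF D R(1) _ e(1) c(1) m(1)]) auto
  moreover have "poly f 0 = e" "poly f 1 = c"
    using m(1) by (simp_all add: f_def poly_interp_poly zero_power)
  moreover have "c dvd poly f a * q" if q: "\<forall>P\<in>S. a \<in> P \<longrightarrow> q \<in> P" for a q
  proof -
    have "(1 - a ^ m) * q \<in> P" if "P \<in> S" for P
      using q m(2)[OF that] mult_in_prime_ideal_iff[OF prime[OF that]] that by blast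
    then have "c dvd e * ((1 - a ^ m) * q)" by (intro dvd) blast
    moreover have "poly f a * q = e * ((1 - a ^ m) * q) + c * (a ^ m * q)"
      by (simp add: f_def poly_interp_poly algebra_simps)
    ultimately show ?thesis by simp
  qed
  moreover have "c \<noteq> 0"
    using c(1) ideal_zero[OF maximal_ideal_imp_ideal[OF R(1)]] by blast
  ultimately have "nonzero_residue_cover S f"
    using c(2) e(2) by (simp add: nonzero_residue_cover_def)
  then show ?thesis ..
qed

lemma ex_separating_elements:
  fixes S :: "'a::idom set set"
  assumes D: "dedekind_domain TYPE('a)" and "finite S" and S: "\<And>P. P \<in> S \<Longrightarrow> is_maximal_ideal P"
    and nonzero: "{0} \<notin> S"
  shows "\<exists>b. \<forall>P\<in>S. \<forall>Q\<in>S. b Q \<in> P \<longleftrightarrow> P = Q"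
proof -
  have "\<exists>x. \<forall>P\<in>S. x \<in> P \<longleftrightarrow> P = Q" if Q: "Q \<in> S" for Q
  proof -
    obtain x where x: "\<And>P. P \<in> S \<Longrightarrow> local_generator P Q x"
      using ex_common_local_generator[OF D \<open>finite S\<close> S nonzero, of Q] Q S nonzero
        maximal_ideal_imp_ideal by metis
    have "x \<in> P \<longleftrightarrow> P = Q" if P: "P \<in> S" for P
      using local_generator_notin[OF maximal_ideal_imp_prime_ideal[OF S[OF P]] x[OF P]] x[OF P]
        maximal_ideal_subset_iff[OF S[OF Q] S[OF P]]
      by (auto simp: local_generator_def)
    then show ?thesis by blast
  qed
  then show ?thesis by metis
qed

lemma irreducible_linear_interpolation:
  fixes b :: "'a::idom"
  assumes "b \<noteq> 1"
  shows "irreducible (fract_poly [:b, 1 - b:])"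
  using assms by (simp add: fract_poly_pCons irreducible_linear_field_poly del: to_fract_diff)

lemma linked_product_linear:
  assumes f: "nonzero_residue_cover S f" and S: "finite S" "\<And>P. P \<in> S \<Longrightarrow> is_prime_ideal P"
    and b: "\<forall>P\<in>S. \<forall>Q\<in>S. b Q \<in> P \<longleftrightarrow> P = Q"
  shows "linked_product f (\<lambda>P. [:b P, 1 - b P:]) S 0 1"
proof
  fix P assume P: "P \<in> S"
  have "b P \<noteq> 1" using b P one_notin_prime_ideal[OF S(2)[OF P]] by metis
  then show "irreducible (fract_poly [:b P, 1 - b P:])"
    by (rule irreducible_linear_interpolation)
  show "\<exists>P'. is_prime_ideal P' \<and> poly f 1 \<in> P' \<and> poly f 0 \<notin> P' \<and>
      (\<forall>Q\<in>S - {P}. poly [:b Q, 1 - b Q:] 0 \<notin> P')"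
    using f b P S(2) by (intro exI[of _ P]) (auto simp: nonzero_residue_cover_def)
next
  have "(\<Prod>Q\<in>S. poly [:b Q, 1 - b Q:] a) \<in> P" if "P \<in> S" "a \<in> P" for P a
  proof -
    have "poly [:b P, 1 - b P:] a \<in> P"
      using b that prime_ideal_imp_ideal[OF S(2)]
      by (auto intro!: ideal_add ideal_mult_right)
    then show ?thesis
      using prod_in_prime_ideal_iff[OF S(2) \<open>finite S\<close>] that(1) by blast
  qed
  then show "poly f 1 dvd poly (f * (\<Prod>P\<in>S. [:b P, 1 - b P:])) a" for a
    using f by (simp add: nonzero_residue_cover_def poly_prod)
qed (use f S(1) in \<open>auto simp: nonzero_residue_cover_def\<close>)

lemma linked_product_X:
  assumes "nonzero_residue_cover S f" "P \<in> S" "is_prime_ideal P"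
  shows "linked_product f (\<lambda>_. [:0, 1:]) {()} 0 1"
proof
  show "poly f 1 dvd poly (f * (\<Prod>i\<in>{()}. [:0, 1:])) a" for a
    using assms(1) by (simp add: nonzero_residue_cover_def mult.commute)
  show "\<exists>P. is_prime_ideal P \<and> poly f 1 \<in> P \<and> poly f 0 \<notin> P \<and>
      (\<forall>i\<in>{()} - {j}. poly [:0, 1 :: 'a:] 0 \<notin> P)" for j
    using assms by (intro exI[of _ P]) (auto simp: nonzero_residue_cover_def)
qed (use assms(1) in \<open>auto simp: nonzero_residue_cover_def fract_poly_pCons irreducible_linear_field_poly\<close>)

lemma ex_irreducible_factorizations:
  fixes S :: "'a::idom set set"
  assumes D: "dedekind_domain TYPE('a)" and "finite S" "S \<noteq> {}" and R: "is_maximal_ideal R" "R \<notin> S"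
    and S: "\<And>P. P \<in> S \<Longrightarrow> is_maximal_ideal P" "\<And>P. P \<in> S \<Longrightarrow> finite_index P"
  shows "\<exists>H G (L :: 'a set \<Rightarrow> 'a fract poly). IntD_irreducible H \<and> IntD_irreducible G \<and>
    (\<forall>P\<in>S. IntD_irreducible (L P)) \<and> [:0, 1:] * H = G * (\<Prod>P\<in>S. L P)"
proof -
  obtain Q where "Q \<in> S" using \<open>S \<noteq> {}\<close> by blast
  have prime: "is_prime_ideal P" if "P \<in> S" for P
    using S(1)[OF that] by (rule maximal_ideal_imp_prime_ideal)
  have nonzero: "{0} \<notin> insert R S"
    using maximal_ideal_nonzero R S(1) \<open>Q \<in> S\<close> by (metis insert_iff)
  obtain f where f: "nonzero_residue_cover S f"
    using ex_nonzero_residue_cover[OF D \<open>finite S\<close> R S nonzero] by blast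
  obtain b where b: "\<forall>P\<in>S. \<forall>Q\<in>S. b Q \<in> P \<longleftrightarrow> P = Q"
    using ex_separating_elements[OF D \<open>finite S\<close> S(1)] nonzero by auto
  define L where "L P = [:b P, 1 - b P:]" for P
  interpret H: linked_product f L S 0 1
    using linked_product_linear[OF f \<open>finite S\<close> prime b] by (simp add: L_def[abs_def])
  interpret G: linked_product f "\<lambda>_. [:0, 1:]" "{()}" 0 1
    using f \<open>Q \<in> S\<close> prime[OF \<open>Q \<in> S\<close>] by (rule linked_product_X)
  have "IntD_irreducible (fract_poly (L P))" if "P \<in> S" for P
    using H.irreducible_L[OF that] H.L_v[OF that] by (rule IntD_irreducible_fract_poly)
  moreover have "[:0, 1:] * H.quotient = G.quotient * (\<Prod>P\<in>S. fract_poly (L P))"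
  proof -
    have "[:0, 1:] * H.quotient = fract_poly [:0, 1:] * quot_poly (f * (\<Prod>P\<in>S. L P)) (poly f 1)"
      by (simp add: H.quotient_def fract_poly_pCons)
    also have "\<dots> = quot_poly (f * [:0, 1:]) (poly f 1) * fract_poly (\<Prod>P\<in>S. L P)"
      unfolding mult_quot_poly quot_poly_mult by (simp only: mult_ac)
    finally show ?thesis by (simp add: G.quotient_def fract_poly_prod)
  qed
  ultimately show ?thesis
    using H.IntD_irreducible_quotient G.IntD_irreducible_quotient
    by (intro exI[of _ H.quotient] exI[of _ G.quotient] exI[of _ "\<lambda>P. fract_poly (L P)"]) simp
qed

lemma prod_Suc_prepend:
  fixes n :: nat and g :: "'a::comm_monoid_mult"
  shows "(\<Prod>i=1..n+1. if i = 1 then g else l (i - 1)) = g * (\<Prod>i=1..n. l i)"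
  by (induction n) (simp_all add: mult.assoc)

theorem theorem5p1:
  fixes n :: nat
  assumes "dedekind_domain TYPE('a::idom)"
    and "infinite {M :: 'a set. is_maximal_ideal M}"
    and "\<forall>M :: 'a set. is_maximal_ideal M \<longrightarrow> finite_index M"
    and "n \<ge> 1"
  shows "\<exists>(H :: 'a fract poly) (G :: nat \<Rightarrow> 'a fract poly).
           H \<in> IntD \<and> IntD_irreducible H \<and>
           (\<forall>i\<in>{1..n+1}. G i \<in> IntD \<and> IntD_irreducible (G i)) \<and>
           [:0, 1:] * H = (\<Prod>i=1..n+1. G i)"
proof -
  obtain P :: "nat \<Rightarrow> 'a set" where "inj P" and P: "\<And>i. is_maximal_ideal (P i)"
    using infinite_countable_subset[OF assms(2)] by auto
  define S where "S = P ` {1..n}"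
  have S: "finite S" "S \<noteq> {}" "\<And>Q. Q \<in> S \<Longrightarrow> is_maximal_ideal Q" "\<And>Q. Q \<in> S \<Longrightarrow> finite_index Q"
    using P assms(3,4) by (auto simp: S_def)
  have "P 0 \<notin> S" using inj_image_mem_iff[OF \<open>inj P\<close>] by (simp add: S_def)
  then obtain H G\<^sub>1 and L :: "'a set \<Rightarrow> 'a fract poly"
    where irreducible: "IntD_irreducible H" "IntD_irreducible G\<^sub>1" "\<And>Q. Q \<in> S \<Longrightarrow> IntD_irreducible (L Q)"
    and eq: "[:0, 1:] * H = G\<^sub>1 * (\<Prod>Q\<in>S. L Q)"
    using ex_irreducible_factorizations[OF assms(1) S(1,2) P, of 0] S(3,4) by blast
  define G where "G i = (if i = 1 then G\<^sub>1 else L (P (i - 1)))" for i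
  have "P (i - 1) \<in> S" if "i \<in> {1..n+1}" "i \<noteq> 1" for i
    using that by (auto simp: S_def intro!: imageI)
  then have "IntD_irreducible (G i)" if "i \<in> {1..n+1}" for i
    using irreducible that by (simp add: G_def)
  moreover have "(\<Prod>Q\<in>S. L Q) = (\<Prod>i=1..n. L (P i))"
    using inj_on_subset[OF \<open>inj P\<close>] by (simp add: S_def prod.reindex)
  then have "[:0, 1:] * H = (\<Prod>i=1..n+1. G i)"
    using eq prod_Suc_prepend[of G\<^sub>1 "\<lambda>i. L (P i)" n] by (simp only: G_def)
  ultimately show ?thesis
    using irreducible(1) by (metis IntD_irreducible_def)
qed

end
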